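(* Let $G$ be a group which is neither the trivial group nor cyclic of order $2$, let $I$ be a set, and let $G[X_i, i\in I]$ be the free product of $G$ and the free group on the set $(X_i)_{i\in I}$, regarded as a $G$-group via the canonical inclusion $G\to G[X_i, i\in I]$. If an element $x\in G[X_i, i\in I]$ is a $T_1$-divisor of zero, then $x\in G$.
   Context: A $G$-group is a group $H$ together with a group homomorphism $f_G^H:G\to H$. For $x\in H$, $G(x)$ denotes the subgroup of $H$ generated by $\{f_G^H(g)\,x\,f_G^H(g)^{-1} : g\in G\}$. For subgroups $L,L'$ of $H$, $[L,L']$ is the subgroup generated by all commutators $ll'l^{-1}l'^{-1}$ with $l\in L$, $l'\in L'$. An element $x\in H$ is a $T_1$-divisor of zero if $x\neq 1$ and there exists $y\in H$, $y\neq 1$, such that $[G(x),G(y)]=1$. *)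

theory Defs
  imports "HOL-Algebra.Algebra"
begin

section \<open>Monoid presentations\<close>

text \<open>The congruence on the words over \<open>A\<close> generated by the relations \<open>R\<close>, and the quotient of the
  free monoid on \<open>A\<close> by it.  Free groups and free products are both obtained in this way; the
  lemmas below show that they are groups and that homomorphisms out of them can be prescribed on
  the generators, respectively the factors.\<close>

inductive_set word_cong :: "'a set \<Rightarrow> ('a list \<times> 'a list) set \<Rightarrow> ('a list \<times> 'a list) set"
  for A R where
    rel: "(l, r) \<in> R \<Longrightarrow> l \<in> lists A \<Longrightarrow> r \<in> lists A \<Longrightarrow> (l, r) \<in> word_cong A R"
  | refl: "w \<in> lists A \<Longrightarrow> (w, w) \<in> word_cong A R"
  | sym: "(u, v) \<in> word_cong A R \<Longrightarrow> (v, u) \<in> word_cong A R"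
  | trans: "(u, v) \<in> word_cong A R \<Longrightarrow> (v, w) \<in> word_cong A R \<Longrightarrow> (u, w) \<in> word_cong A R"
  | append: "(u, u') \<in> word_cong A R \<Longrightarrow> (v, v') \<in> word_cong A R
      \<Longrightarrow> (u @ v, u' @ v') \<in> word_cong A R"

definition word_class :: "'a set \<Rightarrow> ('a list \<times> 'a list) set \<Rightarrow> 'a list \<Rightarrow> 'a list set" where
  "word_class A R w = word_cong A R `` {w}"

definition presented_monoid :: "'a set \<Rightarrow> ('a list \<times> 'a list) set \<Rightarrow> 'a list set monoid" where
  "presented_monoid A R =
    \<lparr>carrier = lists A // word_cong A R,
     monoid.mult = (\<lambda>U V. \<Union>u\<in>U. \<Union>v\<in>V. word_class A R (u @ v)),
     one = word_class A R []\<rparr>"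

lemma word_cong_in_lists:
  assumes "(u, v) \<in> word_cong A R"
  shows "u \<in> lists A" "v \<in> lists A"
  using assms by (induction rule: word_cong.induct) auto

lemma equiv_word_cong: "equiv (lists A) (word_cong A R)"
proof (rule equivI)
  show "word_cong A R \<subseteq> lists A \<times> lists A"
    using word_cong_in_lists by fast
  show "refl_on (lists A) (word_cong A R)"
    by (rule refl_onI) (rule word_cong.refl)
  show "sym (word_cong A R)"
    by (rule symI) (rule word_cong.sym)
  show "trans (word_cong A R)"
    by (rule transI) (rule word_cong.trans)
qed

lemma word_class_eq_iff:
  "u \<in> lists A \<Longrightarrow> v \<in> lists A
    \<Longrightarrow> word_class A R u = word_class A R v \<longleftrightarrow> (u, v) \<in> word_cong A R"
  unfolding word_class_def by (rule eq_equiv_class_iff[OF equiv_word_cong])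

lemma carrier_presented_monoid:
  "carrier (presented_monoid A R) = word_class A R ` lists A"
  unfolding presented_monoid_def quotient_def word_class_def by (simp add: image_def) blast

lemma one_presented_monoid: "\<one>\<^bsub>presented_monoid A R\<^esub> = word_class A R []"
  by (simp add: presented_monoid_def)

lemma mult_presented_monoid:
  assumes "u \<in> lists A" "v \<in> lists A"
  shows "word_class A R u \<otimes>\<^bsub>presented_monoid A R\<^esub> word_class A R v = word_class A R (u @ v)"
proof -
  have "word_class A R (u' @ v') = word_class A R (u @ v)"
    if "u' \<in> word_class A R u" "v' \<in> word_class A R v" for u' v'
  proof -
    have uv: "(u, u') \<in> word_cong A R" "(v, v') \<in> word_cong A R"
      using that by (auto simp: word_class_def)
    hence "(u @ v, u' @ v') \<in> word_cong A R"
      by (rule word_cong.append)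
    thus ?thesis
      using word_cong_in_lists word_class_eq_iff by metis
  qed
  moreover have "u \<in> word_class A R u" "v \<in> word_class A R v"
    using assms by (auto simp: word_class_def intro: word_cong.refl)
  ultimately have "(\<Union>u'\<in>word_class A R u. \<Union>v'\<in>word_class A R v. word_class A R (u' @ v'))
      = word_class A R (u @ v)"
    by blast
  thus ?thesis
    by (simp add: presented_monoid_def)
qed

lemma monoid_presented_monoid: "monoid (presented_monoid A R)"
proof (rule monoidI, unfold carrier_presented_monoid one_presented_monoid)
  show "word_class A R [] \<in> word_class A R ` lists A"
    by (intro imageI) simp
next
  fix x y assume "x \<in> word_class A R ` lists A" "y \<in> word_class A R ` lists A"
  thus "x \<otimes>\<^bsub>presented_monoid A R\<^esub> y \<in> word_class A R ` lists A"
    by (elim imageE) (simp add: mult_presented_monoid)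
qed (elim imageE, simp add: mult_presented_monoid)+

lemma group_presented_monoid:
  assumes "\<And>a. a \<in> A \<Longrightarrow> \<exists>w\<in>lists A. (w @ [a], []) \<in> word_cong A R"
  shows "group (presented_monoid A R)"
proof -
  interpret monoid "presented_monoid A R"
    by (rule monoid_presented_monoid)
  have left_inv: "\<exists>w'\<in>lists A. (w' @ w, []) \<in> word_cong A R" if "w \<in> lists A" for w
    using that
  proof (induction w)
    case Nil
    show ?case by (intro bexI[of _ "[]"]) (auto intro: word_cong.refl)
  next
    case (Cons a w)
    then obtain w' where w': "w' \<in> lists A" "(w' @ w, []) \<in> word_cong A R" by auto
    obtain c where c: "c \<in> lists A" "(c @ [a], []) \<in> word_cong A R"
      using assms[of a] Cons by auto
    have "(w' @ (c @ [a]) @ w, w' @ [] @ w) \<in> word_cong A R"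
      using c w' Cons by (intro word_cong.append word_cong.refl) auto
    hence "((w' @ c) @ a # w, []) \<in> word_cong A R"
      using w' word_cong.trans by fastforce
    thus ?case using w' c by (intro bexI[of _ "w' @ c"]) auto
  qed
  show ?thesis
  proof (rule groupI)
    fix x assume "x \<in> carrier (presented_monoid A R)"
    then obtain w where w: "w \<in> lists A" "x = word_class A R w"
      by (auto simp: carrier_presented_monoid)
    then obtain w' where w': "w' \<in> lists A" "(w' @ w, []) \<in> word_cong A R"
      using left_inv by blast
    hence "word_class A R (w' @ w) = word_class A R []"
      using w by (subst word_class_eq_iff) auto
    thus "\<exists>y\<in>carrier (presented_monoid A R). y \<otimes>\<^bsub>presented_monoid A R\<^esub> x = \<one>\<^bsub>presented_monoid A R\<^esub>"
      using w w' by (intro bexI[of _ "word_class A R w'"])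
        (auto simp: carrier_presented_monoid one_presented_monoid mult_presented_monoid
              del: in_listsD in_listsI)
  qed (auto simp: m_assoc)
qed

lemma presented_monoid_lift:
  assumes "monoid M" and \<phi>: "\<And>a. a \<in> A \<Longrightarrow> \<phi> a \<in> carrier M"
    and R: "\<And>l r. (l, r) \<in> R \<Longrightarrow>
      foldr (\<lambda>a m. \<phi> a \<otimes>\<^bsub>M\<^esub> m) l \<one>\<^bsub>M\<^esub> = foldr (\<lambda>a m. \<phi> a \<otimes>\<^bsub>M\<^esub> m) r \<one>\<^bsub>M\<^esub>"
  shows "\<exists>h \<in> hom (presented_monoid A R) M. \<forall>a\<in>A. h (word_class A R [a]) = \<phi> a"
proof -
  interpret M: monoid M by fact
  define ev where "ev w = foldr (\<lambda>a m. \<phi> a \<otimes>\<^bsub>M\<^esub> m) w \<one>\<^bsub>M\<^esub>" for w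
  have ev_closed: "ev w \<in> carrier M" if "w \<in> lists A" for w
    using that by (induction w) (auto simp: ev_def \<phi>)
  have ev_append: "ev (u @ v) = ev u \<otimes>\<^bsub>M\<^esub> ev v" if "u \<in> lists A" "v \<in> lists A" for u v
    using that
  proof (induction u)
    case (Cons a u)
    have "ev u \<in> carrier M" "ev v \<in> carrier M" using Cons ev_closed by auto
    moreover have "ev (a # w) = \<phi> a \<otimes>\<^bsub>M\<^esub> ev w" for w by (simp add: ev_def)
    ultimately show ?case using Cons \<phi> by (simp add: M.m_assoc)
  qed (use ev_closed in \<open>auto simp: ev_def\<close>)
  have ev_cong: "ev u = ev v" if "(u, v) \<in> word_cong A R" for u v
    using that
  proof (induction rule: word_cong.induct)
    case (append u u' v v')
    thus ?case using word_cong_in_lists ev_append by metis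
  qed (auto simp: ev_def R)
  define h where "h U = ev (SOME w. w \<in> U)" for U
  have h: "h (word_class A R w) = ev w" if "w \<in> lists A" for w
  proof -
    have "w \<in> word_class A R w"
      using that by (auto simp: word_class_def intro: word_cong.refl)
    hence "(SOME w'. w' \<in> word_class A R w) \<in> word_class A R w" by (rule someI)
    thus ?thesis using ev_cong by (auto simp: h_def word_class_def)
  qed
  show ?thesis
  proof (rule bexI[of _ h])
    show "\<forall>a\<in>A. h (word_class A R [a]) = \<phi> a"
      using \<phi> by (auto simp: h ev_def)
    show "h \<in> hom (presented_monoid A R) M"
      by (rule homI; unfold carrier_presented_monoid; elim imageE)
         (simp_all add: mult_presented_monoid h ev_closed ev_append del: in_lists_conv_set)
  qed
qed

section \<open>Free groups and free products\<close>

text \<open>The letter \<open>(i, True)\<close> stands for the generator \<open>X\<^sub>i\<close>, the letter \<open>(i, False)\<close> for its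
  inverse.  \<^const>\<open>Sum_Type.Plus\<close> is not written infix because HOL-Algebra reuses the notation for
  the sum of two subsets of a ring.\<close>

definition free_group :: "'i set \<Rightarrow> ('i \<times> bool) list set monoid" where
  "free_group I =
    presented_monoid (I \<times> UNIV) {([(i, b), (i, \<not> b)], []) | i b. i \<in> I}"

definition free_group_gen :: "'i set \<Rightarrow> 'i \<Rightarrow> ('i \<times> bool) list set" where
  "free_group_gen I i = word_class (I \<times> UNIV) {([(i, b), (i, \<not> b)], []) | i b. i \<in> I} [(i, True)]"

definition free_product_rels ::
  "('a, 'm) monoid_scheme \<Rightarrow> ('b, 'n) monoid_scheme \<Rightarrow> (('a + 'b) list \<times> ('a + 'b) list) set" where
  "free_product_rels G H =
    {([Inl \<one>\<^bsub>G\<^esub>], []), ([Inr \<one>\<^bsub>H\<^esub>], [])}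
    \<union> {([Inl a, Inl a'], [Inl (a \<otimes>\<^bsub>G\<^esub> a')]) | a a'. a \<in> carrier G \<and> a' \<in> carrier G}
    \<union> {([Inr b, Inr b'], [Inr (b \<otimes>\<^bsub>H\<^esub> b')]) | b b'. b \<in> carrier H \<and> b' \<in> carrier H}"

definition free_product ::
  "('a, 'm) monoid_scheme \<Rightarrow> ('b, 'n) monoid_scheme \<Rightarrow> ('a + 'b) list set monoid" where
  "free_product G H =
    presented_monoid (Sum_Type.Plus (carrier G) (carrier H)) (free_product_rels G H)"

definition free_product_inl ::
  "('a, 'm) monoid_scheme \<Rightarrow> ('b, 'n) monoid_scheme \<Rightarrow> 'a \<Rightarrow> ('a + 'b) list set" where
  "free_product_inl G H a =
    word_class (Sum_Type.Plus (carrier G) (carrier H)) (free_product_rels G H) [Inl a]"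

definition free_product_inr ::
  "('a, 'm) monoid_scheme \<Rightarrow> ('b, 'n) monoid_scheme \<Rightarrow> 'b \<Rightarrow> ('a + 'b) list set" where
  "free_product_inr G H b =
    word_class (Sum_Type.Plus (carrier G) (carrier H)) (free_product_rels G H) [Inr b]"

lemma group_free_group: "group (free_group I)"
  unfolding free_group_def
proof (rule group_presented_monoid, clarify)
  fix i :: 'a and b :: bool assume "i \<in> I"
  thus "\<exists>w\<in>lists (I \<times> UNIV). (w @ [(i, b)], [])
      \<in> word_cong (I \<times> UNIV) {([(i, b), (i, \<not> b)], []) | i b. i \<in> I}"
    by (intro bexI[of _ "[(i, \<not> b)]"]) (auto intro!: word_cong.rel)
qed

lemma free_group_lift:
  assumes "group H" "\<And>i. i \<in> I \<Longrightarrow> f i \<in> carrier H"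
  shows "\<exists>h \<in> hom (free_group I) H. \<forall>i\<in>I. h (free_group_gen I i) = f i"
proof -
  interpret H: group H by fact
  have "\<exists>h \<in> hom (free_group I) H. \<forall>a\<in>I \<times> UNIV.
    h (word_class (I \<times> UNIV) {([(i, b), (i, \<not> b)], []) | i b. i \<in> I} [a])
      = (if snd a then f (fst a) else inv\<^bsub>H\<^esub> f (fst a))"
    unfolding free_group_def
    by (rule presented_monoid_lift) (use assms(2) in \<open>auto simp: H.is_monoid\<close>)
  then obtain h where h: "h \<in> hom (free_group I) H" "\<forall>a\<in>I \<times> UNIV.
    h (word_class (I \<times> UNIV) {([(i, b), (i, \<not> b)], []) | i b. i \<in> I} [a])
      = (if snd a then f (fst a) else inv\<^bsub>H\<^esub> f (fst a))"
    by (elim bexE)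
  have "h (free_group_gen I i) = f i" if "i \<in> I" for i
    using bspec[OF h(2), of "(i, True)"] that by (simp add: free_group_gen_def)
  thus ?thesis using h(1) by (intro bexI[of _ h] ballI)
qed

lemma group_free_product:
  assumes "group G" "group H"
  shows "group (free_product G H)"
  unfolding free_product_def
proof (rule group_presented_monoid)
  interpret G: group G by fact
  interpret H: group H by fact
  let ?A = "Sum_Type.Plus (carrier G) (carrier H)"
  let ?C = "word_cong ?A (free_product_rels G H)"
  fix x assume "x \<in> ?A"
  then consider a where "a \<in> carrier G" "x = Inl a" | b where "b \<in> carrier H" "x = Inr b"
    by auto
  thus "\<exists>w\<in>lists ?A. (w @ [x], []) \<in> ?C"
  proof cases
    case 1
    have "([Inl (inv\<^bsub>G\<^esub> a), Inl a], [Inl (inv\<^bsub>G\<^esub> a \<otimes>\<^bsub>G\<^esub> a)]) \<in> ?C"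
      using 1 by (intro word_cong.rel) (auto simp: free_product_rels_def)
    moreover have "([Inl \<one>\<^bsub>G\<^esub>], []) \<in> ?C"
      by (intro word_cong.rel) (auto simp: free_product_rels_def)
    ultimately have "([Inl (inv\<^bsub>G\<^esub> a)] @ [x], []) \<in> ?C"
      using 1 word_cong.trans by fastforce
    thus ?thesis using 1 by (intro bexI[of _ "[Inl (inv\<^bsub>G\<^esub> a)]"]) auto
  next
    case 2
    have "([Inr (inv\<^bsub>H\<^esub> b), Inr b], [Inr (inv\<^bsub>H\<^esub> b \<otimes>\<^bsub>H\<^esub> b)]) \<in> ?C"
      using 2 by (intro word_cong.rel) (auto simp: free_product_rels_def)
    moreover have "([Inr \<one>\<^bsub>H\<^esub>], []) \<in> ?C"
      by (intro word_cong.rel) (auto simp: free_product_rels_def)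
    ultimately have "([Inr (inv\<^bsub>H\<^esub> b)] @ [x], []) \<in> ?C"
      using 2 word_cong.trans by fastforce
    thus ?thesis using 2 by (intro bexI[of _ "[Inr (inv\<^bsub>H\<^esub> b)]"]) auto
  qed
qed

lemma free_product_inl_hom:
  assumes "group G"
  shows "free_product_inl G H \<in> hom G (free_product G H)"
proof (rule homI)
  interpret G: group G by fact
  let ?A = "Sum_Type.Plus (carrier G) (carrier H)"
  fix a a' assume a: "a \<in> carrier G" "a' \<in> carrier G"
  show "free_product_inl G H a \<in> carrier (free_product G H)"
    using a by (auto simp: free_product_inl_def free_product_def carrier_presented_monoid)
  have "([Inl a, Inl a'], [Inl (a \<otimes>\<^bsub>G\<^esub> a')]) \<in> word_cong ?A (free_product_rels G H)"
    using a by (intro word_cong.rel) (auto simp: free_product_rels_def)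
  hence "word_class ?A (free_product_rels G H) [Inl a, Inl a']
      = word_class ?A (free_product_rels G H) [Inl (a \<otimes>\<^bsub>G\<^esub> a')]"
    using a by (subst word_class_eq_iff) auto
  moreover have "[Inl a] \<in> lists ?A" "[Inl a'] \<in> lists ?A" using a by auto
  ultimately show "free_product_inl G H (a \<otimes>\<^bsub>G\<^esub> a')
      = free_product_inl G H a \<otimes>\<^bsub>free_product G H\<^esub> free_product_inl G H a'"
    unfolding free_product_inl_def free_product_def
    by (simp add: mult_presented_monoid)
qed

lemma free_product_lift:
  assumes "group K" and f: "f \<in> hom G K" and g: "g \<in> hom H K" and "group G" "group H"
  shows "\<exists>h \<in> hom (free_product G H) K.
    (\<forall>a\<in>carrier G. h (free_product_inl G H a) = f a) \<and>
    (\<forall>b\<in>carrier H. h (free_product_inr G H b) = g b)"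
proof -
  interpret K: group K by fact
  interpret f: group_hom G K f using assms by (intro group_hom.intro group_hom_axioms.intro)
  interpret g: group_hom H K g using assms by (intro group_hom.intro group_hom_axioms.intro)
  have "\<exists>h \<in> hom (free_product G H) K. \<forall>x\<in>Sum_Type.Plus (carrier G) (carrier H).
    h (word_class (Sum_Type.Plus (carrier G) (carrier H)) (free_product_rels G H) [x]) = case_sum f g x"
    unfolding free_product_def
    by (rule presented_monoid_lift)
       (auto simp: K.is_monoid free_product_rels_def K.m_assoc)
  then obtain h where h: "h \<in> hom (free_product G H) K" "\<forall>x\<in>Sum_Type.Plus (carrier G) (carrier H).
    h (word_class (Sum_Type.Plus (carrier G) (carrier H)) (free_product_rels G H) [x]) = case_sum f g x"
    by (elim bexE)
  have "h (free_product_inl G H a) = f a" if "a \<in> carrier G" for a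
    using bspec[OF h(2), of "Inl a"] that by (simp add: free_product_inl_def InlI)
  moreover have "h (free_product_inr G H b) = g b" if "b \<in> carrier H" for b
    using bspec[OF h(2), of "Inr b"] that by (simp add: free_product_inr_def InrI)
  ultimately show ?thesis using h(1) by (intro bexI[of _ h] conjI ballI)
qed

lemma inj_on_free_product_inl:
  assumes "group G" "group H"
  shows "inj_on (free_product_inl G H) (carrier G)"
proof -
  interpret G: group G by fact
  have "(\<lambda>_. \<one>\<^bsub>G\<^esub>) \<in> hom H G" by (auto simp: hom_def)
  moreover have "(\<lambda>x. x) \<in> hom G G" by (auto simp: hom_def)
  ultimately obtain h where "\<forall>a\<in>carrier G. h (free_product_inl G H a) = a"
    using free_product_lift[of G "\<lambda>x. x" G "\<lambda>_. \<one>\<^bsub>G\<^esub>" H] assms by blast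
  thus ?thesis by (metis inj_on_inverseI)
qed

section \<open>The \<open>G\<close>-group \<open>G[X\<^sub>i, i \<in> I]\<close>\<close>

text \<open>A \<open>G\<close>-group \<open>H\<close> with structure map \<open>f\<close> is an instance of the library locale \<open>group_hom G H f\<close>.\<close>

definition G_free :: "('g, 'm) monoid_scheme \<Rightarrow> 'i set \<Rightarrow> ('g + ('i \<times> bool) list set) list set monoid"
  where "G_free G I = free_product G (free_group I)"

definition G_free_incl ::
  "('g, 'm) monoid_scheme \<Rightarrow> 'i set \<Rightarrow> 'g \<Rightarrow> ('g + ('i \<times> bool) list set) list set"
  where "G_free_incl G I = free_product_inl G (free_group I)"

lemma group_hom_G_free:
  assumes "group G"
  shows "group_hom G (G_free G I) (G_free_incl G I)"
  unfolding G_free_def G_free_incl_def using assms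
  by (intro group_hom.intro group_hom_axioms.intro group_free_product group_free_group
      free_product_inl_hom)

section \<open>Divisors of zero\<close>

definition G_orbit_subgroup ::
  "('g, 'm) monoid_scheme \<Rightarrow> ('h, 'n) monoid_scheme \<Rightarrow> ('g \<Rightarrow> 'h) \<Rightarrow> 'h \<Rightarrow> 'h set" where
  "G_orbit_subgroup G H f x =
    generate H ((\<lambda>g. f g \<otimes>\<^bsub>H\<^esub> x \<otimes>\<^bsub>H\<^esub> inv\<^bsub>H\<^esub> (f g)) ` carrier G)"

definition commutator_subgroup :: "('h, 'n) monoid_scheme \<Rightarrow> 'h set \<Rightarrow> 'h set \<Rightarrow> 'h set" where
  "commutator_subgroup H L L' =
    generate H {l \<otimes>\<^bsub>H\<^esub> l' \<otimes>\<^bsub>H\<^esub> inv\<^bsub>H\<^esub> l \<otimes>\<^bsub>H\<^esub> inv\<^bsub>H\<^esub> l' | l l'. l \<in> L \<and> l' \<in> L'}"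

definition T1_zero_divisor ::
  "('g, 'm) monoid_scheme \<Rightarrow> ('h, 'n) monoid_scheme \<Rightarrow> ('g \<Rightarrow> 'h) \<Rightarrow> 'h \<Rightarrow> bool" where
  "T1_zero_divisor G H f x \<longleftrightarrow>
    x \<in> carrier H \<and> x \<noteq> \<one>\<^bsub>H\<^esub> \<and>
    (\<exists>y \<in> carrier H. y \<noteq> \<one>\<^bsub>H\<^esub> \<and>
      commutator_subgroup H (G_orbit_subgroup G H f x) (G_orbit_subgroup G H f y) = {\<one>\<^bsub>H\<^esub>})"

end

theory Submission
  imports Defs
begin

text \<open>Write \<open>P\<close> for \<open>G[X\<^sub>i, i \<in> I]\<close>.  An element of \<open>P\<close> outside \<open>G\<close> has the form \<open>g q g'\<close> with
  \<open>g, g' \<in> G\<close> and \<open>q\<close> a reduced product: a nonempty product of letters \<open>X\<^sub>i\<close> and \<open>X\<^sub>i\<^sup>-\<^sup>1\<close> separated by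
  elements of \<open>G\<close>, in which no letter is followed by the trivial coefficient and its own inverse.
  Inverses of reduced products are reduced, \<open>p k q\<close> is reduced if \<open>p\<close> and \<open>q\<close> are and \<open>k \<noteq> 1\<close> is in \<open>G\<close>,
  and no reduced product lies in \<open>G\<close>.  The last point is a form of the normal form theorem;
  it is proved by letting \<open>P\<close> act on normal forms (\<open>G_free_action\<close>, \<open>reduced_not_in_image\<close>).

  Suppose that \<open>x \<notin> G\<close> and \<open>y \<noteq> 1\<close>, and that every conjugate of \<open>x\<close> by \<open>G\<close> commutes with every
  conjugate of \<open>y\<close> by \<open>G\<close>.  Conjugating \<open>x\<close> by an element of \<open>G\<close>, one may take \<open>x = a g\<close> with \<open>a\<close>
  reduced and \<open>g \<in> G\<close>.  If \<open>y = k\<close> is in \<open>G\<close>, then \<open>x k x\<^sup>-\<^sup>1 = a (g k g\<^sup>-\<^sup>1) a\<^sup>-\<^sup>1\<close> is reduced, hence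
  different from \<open>k\<close>.  Otherwise take likewise \<open>y = b k\<close>.  For \<open>s \<in> G\<close> the commutator of \<open>x\<close>
  and \<open>s y s\<^sup>-\<^sup>1\<close> is
  \<open>a (g s) b (k s\<^sup>-\<^sup>1 g\<^sup>-\<^sup>1) a\<^sup>-\<^sup>1 (s k\<^sup>-\<^sup>1) b\<^sup>-\<^sup>1 s\<^sup>-\<^sup>1\<close>, which is a reduced product times \<open>s\<^sup>-\<^sup>1\<close>, and so is not
  trivial, unless \<open>s\<close> is one of \<open>g\<^sup>-\<^sup>1\<close>, \<open>g\<^sup>-\<^sup>1 k\<close>, \<open>k\<close>.

  If \<open>g \<noteq> k\<close>, some \<open>s\<close> avoids these: \<open>s = 1\<close> if neither \<open>g\<close> nor \<open>k\<close> is trivial, and otherwise at most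
  two values are excluded while \<open>G\<close> has three elements.  If \<open>g = k\<close> and \<open>k\<^sup>2 = 1\<close>, only \<open>1\<close> and \<open>k\<close> are
  excluded.  If \<open>g = k\<close> and \<open>k\<^sup>2 \<noteq> 1\<close>, one may replace \<open>x\<close> by \<open>x (g x g\<^sup>-\<^sup>1) = (a g\<^sup>2 a) 1\<close>, which still
  commutes with all conjugates of \<open>y\<close> and whose last coefficient \<open>1\<close> differs from \<open>k\<close>.\<close>

section \<open>Subgroups in which reduced products do not collapse\<close>

text \<open>The properties of the set \<open>C\<close> of reduced products on which the commutator argument rests.  The
  letters do not occur in them: the argument only multiplies reduced products across a nontrivial
  coefficient, where no cancellation can take place.\<close>

locale reduced_products = group_hom +
  fixes C
  assumes C_closed: "p \<in> C \<Longrightarrow> p \<in> carrier H"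
    and C_inv: "p \<in> C \<Longrightarrow> inv\<^bsub>H\<^esub> p \<in> C"
    and C_join: "\<lbrakk>p \<in> C; q \<in> C; g \<in> carrier G; g \<noteq> \<one>\<rbrakk> \<Longrightarrow> p \<otimes>\<^bsub>H\<^esub> h g \<otimes>\<^bsub>H\<^esub> q \<in> C"
    and C_outside: "\<lbrakk>p \<in> C; g \<in> carrier G\<rbrakk> \<Longrightarrow> p \<noteq> h g"
    and C_factor: "\<lbrakk>p \<in> carrier H; p \<notin> h ` carrier G\<rbrakk>
      \<Longrightarrow> \<exists>g\<in>carrier G. \<exists>q\<in>C. \<exists>g'\<in>carrier G. p = h g \<otimes>\<^bsub>H\<^esub> q \<otimes>\<^bsub>H\<^esub> h g'"
begin

definition conj_by :: "'a \<Rightarrow> 'c \<Rightarrow> 'c" where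
  "conj_by g p = h g \<otimes>\<^bsub>H\<^esub> p \<otimes>\<^bsub>H\<^esub> inv\<^bsub>H\<^esub> h g"

text \<open>For \<open>p\<close> and \<open>q\<close> to be orthogonal amounts to \<open>[G(p), G(q)] = 1\<close>, since commuting can be tested on
  generators and a pair of conjugates can be conjugated simultaneously.\<close>

definition orth :: "'c \<Rightarrow> 'c \<Rightarrow> bool" where
  "orth p q \<longleftrightarrow> (\<forall>g\<in>carrier G. conj_by g p \<otimes>\<^bsub>H\<^esub> q = q \<otimes>\<^bsub>H\<^esub> conj_by g p)"

lemma H_cancel [simp]:
  assumes "p \<in> carrier H" "q \<in> carrier H"
  shows "p \<otimes>\<^bsub>H\<^esub> (inv\<^bsub>H\<^esub> p \<otimes>\<^bsub>H\<^esub> q) = q" "inv\<^bsub>H\<^esub> p \<otimes>\<^bsub>H\<^esub> (p \<otimes>\<^bsub>H\<^esub> q) = q"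
  using assms by (simp_all add: H.m_assoc[symmetric])

lemma conj_by_closed [simp]:
  "g \<in> carrier G \<Longrightarrow> p \<in> carrier H \<Longrightarrow> conj_by g p \<in> carrier H"
  by (simp add: conj_by_def)

lemma conj_by_mult:
  "\<lbrakk>g \<in> carrier G; p \<in> carrier H; q \<in> carrier H\<rbrakk>
    \<Longrightarrow> conj_by g (p \<otimes>\<^bsub>H\<^esub> q) = conj_by g p \<otimes>\<^bsub>H\<^esub> conj_by g q"
  by (simp add: conj_by_def H.m_assoc)

lemma conj_by_conj_by:
  "\<lbrakk>g \<in> carrier G; g' \<in> carrier G; p \<in> carrier H\<rbrakk>
    \<Longrightarrow> conj_by g (conj_by g' p) = conj_by (g \<otimes> g') p"
  by (simp add: conj_by_def H.m_assoc H.inv_mult_group)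

lemma conj_by_one [simp]: "p \<in> carrier H \<Longrightarrow> conj_by \<one> p = p"
  by (simp add: conj_by_def)

lemma orth_mult:
  assumes "orth p r" "orth q r" "p \<in> carrier H" "q \<in> carrier H" "r \<in> carrier H"
  shows "orth (p \<otimes>\<^bsub>H\<^esub> q) r"
  unfolding orth_def
proof
  fix g assume g: "g \<in> carrier G"
  have "conj_by g p \<otimes>\<^bsub>H\<^esub> conj_by g q \<otimes>\<^bsub>H\<^esub> r = conj_by g p \<otimes>\<^bsub>H\<^esub> (r \<otimes>\<^bsub>H\<^esub> conj_by g q)"
    using assms g by (simp add: orth_def H.m_assoc)
  also have "\<dots> = r \<otimes>\<^bsub>H\<^esub> conj_by g p \<otimes>\<^bsub>H\<^esub> conj_by g q"
    using assms g by (simp add: orth_def H.m_assoc[symmetric])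
  finally show "conj_by g (p \<otimes>\<^bsub>H\<^esub> q) \<otimes>\<^bsub>H\<^esub> r = r \<otimes>\<^bsub>H\<^esub> conj_by g (p \<otimes>\<^bsub>H\<^esub> q)"
    using assms g by (simp add: conj_by_mult H.m_assoc)
qed

lemma orth_conj_left:
  "\<lbrakk>orth p q; g \<in> carrier G; p \<in> carrier H\<rbrakk> \<Longrightarrow> orth (conj_by g p) q"
  by (simp add: orth_def conj_by_conj_by)

lemma orth_conj_right:
  assumes "orth p q" "g \<in> carrier G" "p \<in> carrier H" "q \<in> carrier H"
  shows "orth p (conj_by g q)"
  unfolding orth_def
proof
  fix k assume k: "k \<in> carrier G"
  have "conj_by k p = conj_by g (conj_by (inv g \<otimes> k) p)"
    using assms k by (simp add: conj_by_conj_by G.m_assoc[symmetric])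
  moreover have "conj_by (inv g \<otimes> k) p \<otimes>\<^bsub>H\<^esub> q = q \<otimes>\<^bsub>H\<^esub> conj_by (inv g \<otimes> k) p"
    using assms k by (simp add: orth_def)
  ultimately show "conj_by k p \<otimes>\<^bsub>H\<^esub> conj_by g q = conj_by g q \<otimes>\<^bsub>H\<^esub> conj_by k p"
    using assms k conj_by_mult[symmetric] by simp
qed

text \<open>Conjugation moves the left coefficient of \<open>g q g'\<close> to the right end, so that only one
  coefficient outside the reduced product remains.\<close>

lemma conj_to_right_normal_form:
  assumes "p \<in> carrier H" "p \<notin> h ` carrier G"
  obtains g q g' where "g \<in> carrier G" "q \<in> C" "g' \<in> carrier G" "conj_by g p = q \<otimes>\<^bsub>H\<^esub> h g'"
proof -
  obtain g q g' where p: "g \<in> carrier G" "q \<in> C" "g' \<in> carrier G" "p = h g \<otimes>\<^bsub>H\<^esub> q \<otimes>\<^bsub>H\<^esub> h g'"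
    using C_factor[OF assms] by blast
  have "conj_by (inv g) p = q \<otimes>\<^bsub>H\<^esub> h (g' \<otimes> g)"
    using p C_closed by (simp add: conj_by_def H.m_assoc)
  thus thesis using p by (intro that[of "inv g" q "g' \<otimes> g"]) auto
qed

text \<open>Conjugating \<open>h k\<close> by \<open>q h(g)\<close> gives \<open>q h(g k g\<^sup>-\<^sup>1) q\<^sup>-\<^sup>1\<close>, a reduced product, so the result cannot be
  \<open>h k\<close>.\<close>

lemma not_orth_image:
  assumes "q \<in> C" "g \<in> carrier G" "k \<in> carrier G" "k \<noteq> \<one>"
  shows "\<not> orth (q \<otimes>\<^bsub>H\<^esub> h g) (h k)"
proof
  note [simp] = assms C_closed
  assume "orth (q \<otimes>\<^bsub>H\<^esub> h g) (h k)"
  hence eq: "q \<otimes>\<^bsub>H\<^esub> h g \<otimes>\<^bsub>H\<^esub> h k = h k \<otimes>\<^bsub>H\<^esub> (q \<otimes>\<^bsub>H\<^esub> h g)"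
    unfolding orth_def by (drule_tac bspec[of _ _ \<one>]) simp_all
  have "q \<otimes>\<^bsub>H\<^esub> h (g \<otimes> k \<otimes> inv g) \<otimes>\<^bsub>H\<^esub> inv\<^bsub>H\<^esub> q
      = q \<otimes>\<^bsub>H\<^esub> h g \<otimes>\<^bsub>H\<^esub> h k \<otimes>\<^bsub>H\<^esub> inv\<^bsub>H\<^esub> (q \<otimes>\<^bsub>H\<^esub> h g)"
    by (simp add: H.m_assoc H.inv_mult_group)
  also have "\<dots> = h k"
    unfolding eq by (simp add: H.m_assoc H.inv_mult_group)
  finally have "q \<otimes>\<^bsub>H\<^esub> h (g \<otimes> k \<otimes> inv g) \<otimes>\<^bsub>H\<^esub> inv\<^bsub>H\<^esub> q = h k" .
  moreover have "g \<otimes> k \<otimes> inv g \<noteq> \<one>"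
    using assms by (metis G.inv_closed G.inv_inv G.inv_solve_right' G.l_cancel_one' G.l_one G.m_closed G.one_closed G.r_cancel_one)
  ultimately show False
    using C_outside[OF C_join[OF \<open>q \<in> C\<close> C_inv[OF \<open>q \<in> C\<close>]], of "g \<otimes> k \<otimes> inv g" k] by simp
qed

text \<open>The three excluded values of \<open>s\<close> are those for which one of the coefficients \<open>g s\<close>, \<open>k s\<^sup>-\<^sup>1 g\<^sup>-\<^sup>1\<close>
  and \<open>s k\<^sup>-\<^sup>1\<close> inside the commutator of \<open>a g\<close> and \<open>s (b k) s\<^sup>-\<^sup>1\<close> is trivial.\<close>

lemma not_orth_if_junctions_reduced:
  assumes "a \<in> C" "b \<in> C" "g \<in> carrier G" "k \<in> carrier G" "s \<in> carrier G"
    and s: "s \<noteq> inv g" "s \<noteq> inv g \<otimes> k" "s \<noteq> k"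
  shows "\<not> orth (a \<otimes>\<^bsub>H\<^esub> h g) (b \<otimes>\<^bsub>H\<^esub> h k)"
proof
  note [simp] = assms(1-5) C_closed
  define x where "x = a \<otimes>\<^bsub>H\<^esub> h g"
  define y where "y = conj_by s (b \<otimes>\<^bsub>H\<^esub> h k)"
  have [simp]: "x \<in> carrier H" "y \<in> carrier H" by (simp_all add: x_def y_def)
  assume "orth (a \<otimes>\<^bsub>H\<^esub> h g) (b \<otimes>\<^bsub>H\<^esub> h k)"
  hence "orth x y" unfolding x_def y_def by (intro orth_conj_right) simp_all
  hence eq: "x \<otimes>\<^bsub>H\<^esub> y = y \<otimes>\<^bsub>H\<^esub> x"
    unfolding orth_def by (drule_tac bspec[of _ _ \<one>]) simp_all
  \<comment> \<open>The commutator of \<open>x\<close> and \<open>y\<close> without its last factor \<open>s\<^sup>-\<^sup>1\<close>.\<close>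
  define c where "c = a \<otimes>\<^bsub>H\<^esub> h (g \<otimes> s) \<otimes>\<^bsub>H\<^esub> b \<otimes>\<^bsub>H\<^esub> h (k \<otimes> inv s \<otimes> inv g) \<otimes>\<^bsub>H\<^esub> inv\<^bsub>H\<^esub> a
      \<otimes>\<^bsub>H\<^esub> h (s \<otimes> inv k) \<otimes>\<^bsub>H\<^esub> inv\<^bsub>H\<^esub> b"
  have "c = x \<otimes>\<^bsub>H\<^esub> y \<otimes>\<^bsub>H\<^esub> inv\<^bsub>H\<^esub> x \<otimes>\<^bsub>H\<^esub> inv\<^bsub>H\<^esub> y \<otimes>\<^bsub>H\<^esub> h s"
    by (simp add: c_def x_def y_def conj_by_def H.m_assoc H.inv_mult_group)
  also have "\<dots> = h s"
    unfolding eq by (simp add: H.m_assoc)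
  finally have "c = h s" .
  moreover have "c \<in> C"
    unfolding c_def
  proof (intro C_join C_inv)
    show "g \<otimes> s \<noteq> \<one>" using s(1) by (metis G.inv_comm G.inv_equality assms(3,5))
    show "s \<otimes> inv k \<noteq> \<one>" using s(3) by (metis G.inv_closed G.inv_equality G.inv_inv assms(4,5))
    show "k \<otimes> inv s \<otimes> inv g \<noteq> \<one>"
    proof
      assume "k \<otimes> inv s \<otimes> inv g = \<one>"
      hence "k \<otimes> inv s = g"
        by (metis G.inv_closed G.inv_equality G.inv_inv G.m_closed assms(3,4,5))
      hence "inv g \<otimes> k = s"
        by (auto simp: G.inv_mult_group G.m_assoc)
      thus False using s(2) by simp
    qed
  qed simp_all
  ultimately show False using C_outside by simp
qed

text \<open>The new element is \<open>(q g) (g (q g) g\<^sup>-\<^sup>1) = (q g\<^sup>2 q) 1\<close>: conjugating the second factor by \<open>g\<close>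
  removes the coefficient at the end.\<close>

lemma twist_orth:
  assumes "orth (q \<otimes>\<^bsub>H\<^esub> h g) y" "q \<in> C" "g \<in> carrier G" "g \<otimes> g \<noteq> \<one>" "y \<in> carrier H"
  obtains q' where "q' \<in> C" "orth (q' \<otimes>\<^bsub>H\<^esub> h \<one>) y"
proof -
  note [simp] = assms(2,3,5) C_closed
  have "(q \<otimes>\<^bsub>H\<^esub> h g) \<otimes>\<^bsub>H\<^esub> conj_by g (q \<otimes>\<^bsub>H\<^esub> h g) = q \<otimes>\<^bsub>H\<^esub> h (g \<otimes> g) \<otimes>\<^bsub>H\<^esub> q \<otimes>\<^bsub>H\<^esub> h \<one>"
    by (simp add: conj_by_def H.m_assoc)
  moreover have "orth ((q \<otimes>\<^bsub>H\<^esub> h g) \<otimes>\<^bsub>H\<^esub> conj_by g (q \<otimes>\<^bsub>H\<^esub> h g)) y"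
    by (rule orth_mult[OF assms(1) orth_conj_left[OF assms(1)]]) simp_all
  ultimately show thesis
    using assms(4) by (intro that[of "q \<otimes>\<^bsub>H\<^esub> h (g \<otimes> g) \<otimes>\<^bsub>H\<^esub> q"] C_join) simp_all
qed

text \<open>With at least three elements in \<open>G\<close> the excluded values of \<open>s\<close> leave one free, except possibly if
  \<open>g = k\<close> and \<open>g\<^sup>2 \<noteq> \<one>\<close>; there \<open>twist_orth\<close> changes \<open>g\<close> to \<open>\<one>\<close>.\<close>

lemma not_orth_right_normal_forms:
  assumes third: "\<And>u v. \<exists>s\<in>carrier G. s \<noteq> u \<and> s \<noteq> v"
    and "a \<in> C" "b \<in> C" "g \<in> carrier G" "k \<in> carrier G"
  shows "\<not> orth (a \<otimes>\<^bsub>H\<^esub> h g) (b \<otimes>\<^bsub>H\<^esub> h k)"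
proof -
  \<comment> \<open>Stated for arbitrary \<open>a\<close> and \<open>g\<close> because it is used again after the twist.\<close>
  have distinct_ends: "\<not> orth (a \<otimes>\<^bsub>H\<^esub> h g) (b \<otimes>\<^bsub>H\<^esub> h k)"
    if "a \<in> C" "g \<in> carrier G" "g \<noteq> k" for a g
  proof -
    have "\<exists>s\<in>carrier G. s \<noteq> inv g \<and> s \<noteq> inv g \<otimes> k \<and> s \<noteq> k"
    proof (cases "g = \<one> \<or> k = \<one>")
      case True
      thus ?thesis using third[of \<one> k] third[of \<one> "inv g"] assms that by auto
    next
      case False
      hence "\<one> \<noteq> inv g" "\<one> \<noteq> k" using that by (metis G.inv_eq_1_iff)+
      moreover have "\<one> \<noteq> inv g \<otimes> k"
        using that assms by (metis G.inv_closed G.inv_equality G.inv_inv G.inv_comm)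
      ultimately show ?thesis by blast
    qed
    thus ?thesis using not_orth_if_junctions_reduced that assms by blast
  qed
  show ?thesis
  proof (cases "g = k")
    case False
    thus ?thesis using distinct_ends assms by simp
  next
    case gk: True
    show ?thesis
    proof (cases "k \<otimes> k = \<one>")
      case True
      obtain s where "s \<in> carrier G" "s \<noteq> \<one>" "s \<noteq> k" using third by blast
      moreover have "inv k = k" using True assms G.inv_equality by blast
      ultimately show ?thesis
        using not_orth_if_junctions_reduced[of a b k k s] assms(2-5) gk True by simp
    next
      case False
      hence "\<one> \<noteq> k" using assms(5) by auto
      show ?thesis
      proof
        assume "orth (a \<otimes>\<^bsub>H\<^esub> h g) (b \<otimes>\<^bsub>H\<^esub> h k)"
        then obtain a' where "a' \<in> C" "orth (a' \<otimes>\<^bsub>H\<^esub> h \<one>) (b \<otimes>\<^bsub>H\<^esub> h k)"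
          using twist_orth[of a k "b \<otimes>\<^bsub>H\<^esub> h k"] False assms(2-5) gk C_closed by auto
        thus False using distinct_ends \<open>\<one> \<noteq> k\<close> by blast
      qed
    qed
  qed
qed

theorem orth_left_in_image:
  assumes "\<And>u v. \<exists>s\<in>carrier G. s \<noteq> u \<and> s \<noteq> v"
    and "orth x y" "x \<in> carrier H" "y \<in> carrier H" "y \<noteq> \<one>\<^bsub>H\<^esub>"
  shows "x \<in> h ` carrier G"
proof (rule ccontr)
  assume "x \<notin> h ` carrier G"
  then obtain g a g' where a: "g \<in> carrier G" "a \<in> C" "g' \<in> carrier G" "conj_by g x = a \<otimes>\<^bsub>H\<^esub> h g'"
    using conj_to_right_normal_form assms by metis
  hence orth: "orth (a \<otimes>\<^bsub>H\<^esub> h g') y" using orth_conj_left assms by metis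
  show False
  proof (cases "y \<in> h ` carrier G")
    case True
    then obtain k where "k \<in> carrier G" "y = h k" by blast
    moreover from this have "k \<noteq> \<one>" using assms hom_one by blast
    ultimately show False using not_orth_image orth a by blast
  next
    case False
    then obtain k b k' where b: "k \<in> carrier G" "b \<in> C" "k' \<in> carrier G"
      "conj_by k y = b \<otimes>\<^bsub>H\<^esub> h k'"
      using conj_to_right_normal_form assms by metis
    hence "orth (a \<otimes>\<^bsub>H\<^esub> h g') (b \<otimes>\<^bsub>H\<^esub> h k')"
      using orth_conj_right[OF orth] a C_closed assms by (metis H.m_closed hom_closed)
    thus False using not_orth_right_normal_forms assms a b by blast
  qed
qed

end

section \<open>Groups with at least three elements\<close>

lemma (in group) ex_third_element:
  assumes "\<not> trivial_group G" "\<not> (cyclic_group G \<and> order G = 2)"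
  shows "\<exists>s\<in>carrier G. s \<noteq> u \<and> s \<noteq> v"
proof (rule ccontr)
  assume "\<not> ?thesis"
  hence sub: "\<And>s. s \<in> carrier G \<Longrightarrow> s = u \<or> s = v" by blast
  obtain w where w: "w \<in> carrier G" "w \<noteq> \<one>"
    using assms(1) trivial_group_subset by auto
  have carrier: "carrier G = {\<one>, w}"
  proof (intro equalityI subsetI)
    fix s assume "s \<in> carrier G"
    thus "s \<in> {\<one>, w}" using sub[of s] sub[of w] sub[of \<one>] w by auto
  qed (use w in auto)
  have "carrier G = range (\<lambda>n::int. w [^] n)"
  proof
    have "\<one> = w [^] (0::int)" "w = w [^] (1::int)"
      using w by simp_all
    thus "carrier G \<subseteq> range (\<lambda>n::int. w [^] n)"
      unfolding carrier by (metis empty_subsetI insert_subset rangeI)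
    show "range (\<lambda>n::int. w [^] n) \<subseteq> carrier G"
      using int_pow_closed[OF w(1)] by auto
  qed
  hence "cyclic_group G"
    using w(1) unfolding cyclic_group by (intro bexI[of _ w]) auto
  moreover have "order G = 2" 
    unfolding order_def carrier using w(2) by simp
  ultimately show False using assms(2) by simp
qed

section \<open>Generators of \<open>G[X\<^sub>i, i \<in> I]\<close>\<close>

lemma free_product_inr_hom:
  assumes "group H"
  shows "free_product_inr G H \<in> hom H (free_product G H)"
proof (rule homI)
  interpret H: group H by fact
  let ?A = "Sum_Type.Plus (carrier G) (carrier H)"
  fix b b' assume b: "b \<in> carrier H" "b' \<in> carrier H"
  show "free_product_inr G H b \<in> carrier (free_product G H)"
    using b by (auto simp: free_product_inr_def free_product_def carrier_presented_monoid)
  have "([Inr b, Inr b'], [Inr (b \<otimes>\<^bsub>H\<^esub> b')]) \<in> word_cong ?A (free_product_rels G H)"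
    using b by (intro word_cong.rel) (auto simp: free_product_rels_def)
  hence "word_class ?A (free_product_rels G H) [Inr b, Inr b']
      = word_class ?A (free_product_rels G H) [Inr (b \<otimes>\<^bsub>H\<^esub> b')]"
    using b by (subst word_class_eq_iff) auto
  moreover have "[Inr b] \<in> lists ?A" "[Inr b'] \<in> lists ?A" using b by auto
  ultimately show "free_product_inr G H (b \<otimes>\<^bsub>H\<^esub> b')
      = free_product_inr G H b \<otimes>\<^bsub>free_product G H\<^esub> free_product_inr G H b'"
    unfolding free_product_inr_def free_product_def
    by (simp add: mult_presented_monoid)
qed

text \<open>These induction rules express that the letters and \<open>G\<close> generate, in the form of words read from the
  left; they take the place of the uniqueness part of the universal properties.\<close>

lemma presented_monoid_induct [consumes 1, case_names one mult]:
  assumes "p \<in> carrier (presented_monoid A R)"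
    and "Q \<one>\<^bsub>presented_monoid A R\<^esub>"
    and "\<And>a q. \<lbrakk>a \<in> A; q \<in> carrier (presented_monoid A R); Q q\<rbrakk>
      \<Longrightarrow> Q (word_class A R [a] \<otimes>\<^bsub>presented_monoid A R\<^esub> q)"
  shows "Q p"
proof -
  have "Q (word_class A R w)" if "w \<in> lists A" for w
    using that
  proof (induction w)
    case Nil
    show ?case using assms(2) by (simp add: one_presented_monoid)
  next
    case (Cons a w)
    thus ?case
      using assms(3)[of a "word_class A R w"] mult_presented_monoid[of "[a]" A w R]
      by (simp add: carrier_presented_monoid)
  qed
  thus ?thesis using assms(1) by (auto simp: carrier_presented_monoid)
qed

lemma free_product_induct [consumes 3, case_names one inl inr]:
  assumes "group G" "group H" "p \<in> carrier (free_product G H)"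
    and "Q \<one>\<^bsub>free_product G H\<^esub>"
    and "\<And>a q. \<lbrakk>a \<in> carrier G; q \<in> carrier (free_product G H); Q q\<rbrakk>
      \<Longrightarrow> Q (free_product_inl G H a \<otimes>\<^bsub>free_product G H\<^esub> q)"
    and "\<And>b q. \<lbrakk>b \<in> carrier H; q \<in> carrier (free_product G H); Q q\<rbrakk>
      \<Longrightarrow> Q (free_product_inr G H b \<otimes>\<^bsub>free_product G H\<^esub> q)"
  shows "Q p"
  using assms(3) unfolding free_product_def
proof (induction rule: presented_monoid_induct)
  case one
  show ?case using assms(4) by (simp add: free_product_def)
next
  case (mult a q)
  thus ?case using assms(5,6)[of _ q]
    by (auto simp: free_product_def free_product_inl_def free_product_inr_def)
qed

text \<open>The inverse letter: \<open>(i, True)\<close> stands for \<open>X\<^sub>i\<close> and \<open>(i, False)\<close> for its inverse.\<close>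

fun flip :: "'i \<times> bool \<Rightarrow> 'i \<times> bool" where
  "flip (i, b) = (i, \<not> b)"

lemma flip_flip [simp]: "flip (flip a) = a"
  by (cases a) simp

lemma flip_in_iff [simp]: "flip a \<in> I \<times> UNIV \<longleftrightarrow> a \<in> I \<times> UNIV"
  by (cases a) simp

definition free_group_letter :: "'i set \<Rightarrow> 'i \<times> bool \<Rightarrow> ('i \<times> bool) list set" where
  "free_group_letter I a = word_class (I \<times> UNIV) {([(i, b), (i, \<not> b)], []) | i b. i \<in> I} [a]"

lemma free_group_letter_closed [simp]:
  "a \<in> I \<times> UNIV \<Longrightarrow> free_group_letter I a \<in> carrier (free_group I)"
  by (auto simp: free_group_letter_def free_group_def carrier_presented_monoid)

lemma free_group_letter_mult_flip:
  assumes "a \<in> I \<times> UNIV"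
  shows "free_group_letter I a \<otimes>\<^bsub>free_group I\<^esub> free_group_letter I (flip a) = \<one>\<^bsub>free_group I\<^esub>"
proof -
  let ?R = "{([(i, b), (i, \<not> b)], []) | i b. i \<in> I}"
  have lists: "[a] \<in> lists (I \<times> UNIV)" "[flip a] \<in> lists (I \<times> UNIV)"
    "[a, flip a] \<in> lists (I \<times> UNIV)" "[] \<in> lists (I \<times> UNIV)"
    using assms by simp_all
  have "([a, flip a], []) \<in> ?R"
    using assms by (cases a) auto
  hence "([a, flip a], []) \<in> word_cong (I \<times> UNIV) ?R"
    using lists by (intro word_cong.rel)
  hence "word_class (I \<times> UNIV) ?R [a, flip a] = word_class (I \<times> UNIV) ?R []"
    using word_class_eq_iff[OF lists(3,4)] by blast
  thus ?thesis
    using mult_presented_monoid[OF lists(1,2), of ?R]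
    by (simp only: free_group_letter_def free_group_def one_presented_monoid append.simps)
qed

lemma free_group_induct [consumes 1, case_names one mult]:
  assumes "b \<in> carrier (free_group I)"
    and "Q \<one>\<^bsub>free_group I\<^esub>"
    and "\<And>a c. \<lbrakk>a \<in> I \<times> UNIV; c \<in> carrier (free_group I); Q c\<rbrakk>
      \<Longrightarrow> Q (free_group_letter I a \<otimes>\<^bsub>free_group I\<^esub> c)"
  shows "Q b"
  using assms unfolding free_group_def free_group_letter_def by (rule presented_monoid_induct)

definition letter :: "('g, 'm) monoid_scheme \<Rightarrow> 'i set \<Rightarrow> 'i \<times> bool
    \<Rightarrow> ('g + ('i \<times> bool) list set) list set" where
  "letter G I a = free_product_inr G (free_group I) (free_group_letter I a)"

locale G_free_group = G: group G for G :: "('g, 'm) monoid_scheme" (structure) + fixes I :: "'i set"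
begin

abbreviation P where "P \<equiv> G_free G I"
abbreviation inc where "inc \<equiv> G_free_incl G I"
abbreviation letters where "letters \<equiv> I \<times> (UNIV :: bool set)"

sublocale inc: group_hom G P inc
  by (rule group_hom_G_free) (rule G.group_axioms)

lemma inr_hom: "group_hom (free_group I) P (free_product_inr G (free_group I))"
  unfolding G_free_def
  by (intro group_hom.intro group_hom_axioms.intro group_free_product group_free_group
      free_product_inr_hom G.group_axioms)

lemma letter_closed [simp]: "a \<in> letters \<Longrightarrow> letter G I a \<in> carrier P"
  unfolding letter_def by (intro group_hom.hom_closed[OF inr_hom]) simp

lemma letter_mult_flip:
  assumes "a \<in> letters"
  shows "letter G I a \<otimes>\<^bsub>P\<^esub> letter G I (flip a) = \<one>\<^bsub>P\<^esub>"
proof -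
  interpret r: group_hom "free_group I" P "free_product_inr G (free_group I)" by (rule inr_hom)
  have "letter G I a \<otimes>\<^bsub>P\<^esub> letter G I (flip a)
      = free_product_inr G (free_group I)
          (free_group_letter I a \<otimes>\<^bsub>free_group I\<^esub> free_group_letter I (flip a))"
    unfolding letter_def by (rule r.hom_mult[symmetric]) (use assms in simp_all)
  also have "\<dots> = \<one>\<^bsub>P\<^esub>"
    unfolding free_group_letter_mult_flip[OF assms] by (rule r.hom_one)
  finally show ?thesis .
qed

lemma inv_letter:
  assumes "a \<in> letters"
  shows "inv\<^bsub>P\<^esub> letter G I a = letter G I (flip a)"
  using letter_mult_flip[of "flip a"] assms by (intro inc.H.inv_equality) simp_all

lemma G_free_induct [consumes 1, case_names one incl letter]:
  assumes "p \<in> carrier P"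
    and "Q \<one>\<^bsub>P\<^esub>"
    and incl: "\<And>g q. \<lbrakk>g \<in> carrier G; q \<in> carrier P; Q q\<rbrakk> \<Longrightarrow> Q (inc g \<otimes>\<^bsub>P\<^esub> q)"
    and letter: "\<And>a q. \<lbrakk>a \<in> letters; q \<in> carrier P; Q q\<rbrakk> \<Longrightarrow> Q (letter G I a \<otimes>\<^bsub>P\<^esub> q)"
  shows "Q p"
  using G.group_axioms group_free_group assms(1)[unfolded G_free_def]
proof (induction rule: free_product_induct)
  case one
  show ?case using assms(2) by (simp add: G_free_def)
next
  case (inl a q)
  thus ?case using incl by (simp add: G_free_def G_free_incl_def)
next
  case (inr b q)
  interpret r: group_hom "free_group I" P "free_product_inr G (free_group I)" by (rule inr_hom)
  have "free_product_inr G (free_group I) b \<otimes>\<^bsub>P\<^esub> q \<in> carrier P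
      \<and> Q (free_product_inr G (free_group I) b \<otimes>\<^bsub>P\<^esub> q)"
    using inr(1)
  proof (induction rule: free_group_induct)
    case one
    show ?case using inr r.hom_one by (simp flip: G_free_def)
  next
    case (mult a c)
    have "free_product_inr G (free_group I) (free_group_letter I a \<otimes>\<^bsub>free_group I\<^esub> c) \<otimes>\<^bsub>P\<^esub> q
        = letter G I a \<otimes>\<^bsub>P\<^esub> (free_product_inr G (free_group I) c \<otimes>\<^bsub>P\<^esub> q)"
      using mult inr
      by (simp add: letter_def inc.H.m_assoc flip: G_free_def)
    thus ?case using mult letter[of a "free_product_inr G (free_group I) c \<otimes>\<^bsub>P\<^esub> q"]
      by simp
  qed
  thus ?case by (simp add: G_free_def)
qed

lemma G_free_lift:
  assumes "group K" "\<phi> \<in> hom G K" "\<And>i. i \<in> I \<Longrightarrow> t i \<in> carrier K"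
  obtains h where "group_hom P K h" "\<And>g. g \<in> carrier G \<Longrightarrow> h (inc g) = \<phi> g"
    "\<And>i. i \<in> I \<Longrightarrow> h (letter G I (i, True)) = t i"
proof -
  obtain f where f: "f \<in> hom (free_group I) K" "\<forall>i\<in>I. f (free_group_letter I (i, True)) = t i"
    using free_group_lift[of K I t] assms
    unfolding free_group_letter_def free_group_gen_def by blast
  obtain h where h: "h \<in> hom (free_product G (free_group I)) K"
    "\<forall>a\<in>carrier G. h (free_product_inl G (free_group I) a) = \<phi> a"
    "\<forall>b\<in>carrier (free_group I). h (free_product_inr G (free_group I) b) = f b"
    using free_product_lift[OF assms(1,2) f(1) G.group_axioms group_free_group] by blast
  have "group_hom P K h"
    using h(1) assms(1) inc.H.group_axioms
    by (simp add: group_hom_def group_hom_axioms_def G_free_def)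
  thus thesis using h f(2) by (intro that) (auto simp: G_free_incl_def letter_def)
qed

section \<open>The action on normal forms\<close>

text \<open>The pair \<open>(g, [(a\<^sub>1, k\<^sub>1), \<dots>, (a\<^sub>n, k\<^sub>n)])\<close> stands for the product \<open>g a\<^sub>1 k\<^sub>1 \<dots> a\<^sub>n k\<^sub>n\<close>.\<close>

fun is_normal_form :: "'g \<times> (('i \<times> bool) \<times> 'g) list \<Rightarrow> bool" where
  "is_normal_form (g, []) \<longleftrightarrow> g \<in> carrier G"
| "is_normal_form (g, (a, k) # w) \<longleftrightarrow> g \<in> carrier G \<and> a \<in> letters
    \<and> (k = \<one> \<longrightarrow> w = [] \<or> fst (hd w) \<noteq> flip a) \<and> is_normal_form (k, w)"

definition normal_forms :: "('g \<times> (('i \<times> bool) \<times> 'g) list) set" where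
  "normal_forms = Collect is_normal_form"

text \<open>Left multiplication of a normal form by a letter and by an element of \<open>G\<close>.  Their values are again
  normal forms, which is what makes them permutations of the set of normal forms.\<close>

fun push :: "'i \<times> bool \<Rightarrow> 'g \<times> (('i \<times> bool) \<times> 'g) list \<Rightarrow> 'g \<times> (('i \<times> bool) \<times> 'g) list" where
  "push a (g, []) = (\<one>, [(a, g)])"
| "push a (g, (b, k) # w) =
    (if g = \<one> \<and> b = flip a then (k, w) else (\<one>, (a, g) # (b, k) # w))"

fun scale :: "'g \<Rightarrow> 'g \<times> (('i \<times> bool) \<times> 'g) list \<Rightarrow> 'g \<times> (('i \<times> bool) \<times> 'g) list" where
  "scale g (k, w) = (g \<otimes> k, w)"

lemma normal_form_head: "(g, w) \<in> normal_forms \<Longrightarrow> g \<in> carrier G"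
  by (cases w) (auto simp: normal_forms_def)

lemma push_closed:
  "a \<in> letters \<Longrightarrow> s \<in> normal_forms \<Longrightarrow> push a s \<in> normal_forms"
  by (cases "(a, s)" rule: push.cases) (auto simp: normal_forms_def)

text \<open>If \<open>a\<close> cancels against the first letter of \<open>s\<close>, the remaining normal form cannot permit a second
  cancellation, because \<open>s\<close> was reduced; so the inverse letter puts the cancelled one back.\<close>

lemma push_flip_push:
  assumes "s \<in> normal_forms"
  shows "push (flip a) (push a s) = s"
proof (cases "(a, s)" rule: push.cases)
  case (1 a' g)
  thus ?thesis by simp
next
  case (2 a' g b k w)
  show ?thesis
  proof (cases "g = \<one> \<and> b = flip a")
    case True
    thus ?thesis using 2 assms by (cases w) (auto simp: normal_forms_def)
  next
    case False
    hence "push a s = (\<one>, (a, g) # (b, k) # w)" using 2 by simp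
    thus ?thesis using 2 by simp
  qed
qed

lemma scale_closed:
  assumes "g \<in> carrier G" "s \<in> normal_forms"
  shows "scale g s \<in> normal_forms"
  using assms by (cases s; cases "snd s") (auto simp: normal_forms_def)

lemma scale_scale:
  "\<lbrakk>g \<in> carrier G; g' \<in> carrier G; s \<in> normal_forms\<rbrakk> \<Longrightarrow> scale g (scale g' s) = scale (g \<otimes> g') s"
  by (cases s) (auto dest: normal_form_head simp: G.m_assoc)

lemma scale_one: "s \<in> normal_forms \<Longrightarrow> scale \<one> s = s"
  by (cases s) (auto dest: normal_form_head)

lemma restrict_push_Bij:
  assumes "a \<in> letters"
  shows "restrict (push a) normal_forms \<in> Bij normal_forms"
proof -
  have "bij_betw (push a) normal_forms normal_forms"
  proof (rule bij_betw_byWitness[where f' = "push (flip a)"])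
    show "\<forall>s\<in>normal_forms. push (flip a) (push a s) = s"
      using push_flip_push by blast
    show "\<forall>s\<in>normal_forms. push a (push (flip a) s) = s"
      using push_flip_push[where a = "flip a"] by (simp only: flip_flip) blast
    show "push a ` normal_forms \<subseteq> normal_forms" "push (flip a) ` normal_forms \<subseteq> normal_forms"
      using push_closed[of a] push_closed[of "flip a"] assms
      by (simp_all only: flip_in_iff image_subset_iff) simp_all
  qed
  thus ?thesis by (simp add: Bij_def)
qed

lemma restrict_scale_Bij:
  assumes "g \<in> carrier G"
  shows "restrict (scale g) normal_forms \<in> Bij normal_forms"
proof -
  have "bij_betw (scale g) normal_forms normal_forms"
  proof (rule bij_betw_byWitness[where f' = "scale (inv g)"])
    show "\<forall>s\<in>normal_forms. scale (inv g) (scale g s) = s"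
      using assms by (simp add: scale_scale scale_one del: scale.simps split_paired_All)
    show "\<forall>s\<in>normal_forms. scale g (scale (inv g) s) = s"
      using assms by (simp add: scale_scale scale_one del: scale.simps split_paired_All)
    show "scale g ` normal_forms \<subseteq> normal_forms" "scale (inv g) ` normal_forms \<subseteq> normal_forms"
      using assms scale_closed by blast+
  qed
  thus ?thesis by (simp add: Bij_def)
qed

text \<open>The universal property turns the permutations \<open>push a\<close> and \<open>scale g\<close> into an action of \<open>P\<close>.\<close>

lemma G_free_action:
  obtains act where
    "\<And>p q s. \<lbrakk>p \<in> carrier P; q \<in> carrier P; s \<in> normal_forms\<rbrakk> \<Longrightarrow> act (p \<otimes>\<^bsub>P\<^esub> q) s = act p (act q s)"
    "\<And>g s. \<lbrakk>g \<in> carrier G; s \<in> normal_forms\<rbrakk> \<Longrightarrow> act (inc g) s = scale g s"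
    "\<And>a s. \<lbrakk>a \<in> letters; s \<in> normal_forms\<rbrakk> \<Longrightarrow> act (letter G I a) s = push a s"
proof -
  let ?S = normal_forms
  let ?B = "BijGroup ?S"
  have carrier: "carrier ?B = Bij ?S"
    and mult: "\<And>f f'. \<lbrakk>f \<in> Bij ?S; f' \<in> Bij ?S\<rbrakk> \<Longrightarrow> f \<otimes>\<^bsub>?B\<^esub> f' = compose ?S f f'"
    and one: "\<one>\<^bsub>?B\<^esub> = (\<lambda>s\<in>?S. s)"
    by (simp_all add: BijGroup_def)
  have "restrict (scale (g \<otimes> g')) ?S = restrict (scale g) ?S \<otimes>\<^bsub>?B\<^esub> restrict (scale g') ?S"
    if "g \<in> carrier G" "g' \<in> carrier G" for g g'
  proof -
    have "restrict (scale (g \<otimes> g')) ?S = compose ?S (restrict (scale g) ?S) (restrict (scale g') ?S)"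
      unfolding compose_def
    proof (rule restrict_ext)
      fix s assume "s \<in> ?S"
      thus "scale (g \<otimes> g') s = restrict (scale g) ?S (restrict (scale g') ?S s)"
        using that scale_closed by (simp add: scale_scale)
    qed
    thus ?thesis using that by (simp add: mult restrict_scale_Bij)
  qed
  hence "(\<lambda>g. restrict (scale g) ?S) \<in> hom G ?B"
    by (intro homI) (simp_all add: carrier restrict_scale_Bij)
  then obtain act where "group_hom P ?B act"
    and G: "\<And>g. g \<in> carrier G \<Longrightarrow> act (inc g) = restrict (scale g) ?S"
    and X: "\<And>i. i \<in> I \<Longrightarrow> act (letter G I (i, True)) = restrict (push (i, True)) ?S"
    using G_free_lift[of ?B "\<lambda>g. restrict (scale g) ?S" "\<lambda>i. restrict (push (i, True)) ?S"]
    by (auto simp: group_BijGroup carrier restrict_push_Bij)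
  then interpret act: group_hom P ?B act by simp
  have letter: "act (letter G I a) = restrict (push a) ?S" if a: "a \<in> letters" for a
  proof (cases a)
    case (Pair i b)
    show ?thesis
    proof (cases b)
      case True
      thus ?thesis using X Pair a by auto
    next
      case False
      have i: "(i, True) \<in> letters" using Pair a by auto
      have "restrict (push a) ?S \<otimes>\<^bsub>?B\<^esub> restrict (push (i, True)) ?S = \<one>\<^bsub>?B\<^esub>"
        using a i push_flip_push[of _ "(i, True)"] push_closed[OF i] Pair False
        by (auto simp: mult one restrict_push_Bij compose_def intro!: restrict_ext)
      hence "inv\<^bsub>?B\<^esub> restrict (push (i, True)) ?S = restrict (push a) ?S"
        using a i by (intro act.H.inv_equality) (auto simp: carrier restrict_push_Bij)
      moreover have "letter G I a = inv\<^bsub>P\<^esub> letter G I (i, True)"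
        using inv_letter[OF i] Pair False by simp
      ultimately show ?thesis using i X[of i] by (simp add: act.hom_inv)
    qed
  qed
  show thesis
  proof (rule that)
    fix p q s assume "p \<in> carrier P" "q \<in> carrier P" "s \<in> ?S"
    thus "act (p \<otimes>\<^bsub>P\<^esub> q) s = act p (act q s)"
      using act.hom_closed[of p] act.hom_closed[of q]
      by (simp add: carrier mult compose_def)
  qed (simp_all add: G letter)
qed

section \<open>Reduced products\<close>

text \<open>The predicate records the first and the last letter, since these decide whether two reduced products
  may be joined across the trivial coefficient.\<close>

inductive reduced :: "'i \<times> bool \<Rightarrow> ('g + ('i \<times> bool) list set) list set \<Rightarrow> 'i \<times> bool \<Rightarrow> bool" where
  letter: "a \<in> letters \<Longrightarrow> reduced a (letter G I a) a"
| Cons: "\<lbrakk>reduced c p b; a \<in> letters; g \<in> carrier G; g = \<one> \<longrightarrow> c \<noteq> flip a\<rbrakk>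
    \<Longrightarrow> reduced a (letter G I a \<otimes>\<^bsub>P\<^esub> inc g \<otimes>\<^bsub>P\<^esub> p) b"

lemma reduced_closed:
  assumes "reduced a p b"
  shows "a \<in> letters" "p \<in> carrier P" "b \<in> letters"
  using assms by (induction) auto

lemma reduced_join:
  assumes "reduced a p b" "reduced c q d" "g \<in> carrier G" "g = \<one> \<longrightarrow> c \<noteq> flip b"
  shows "reduced a (p \<otimes>\<^bsub>P\<^esub> inc g \<otimes>\<^bsub>P\<^esub> q) d"
  using assms
proof (induction)
  case (letter a)
  thus ?case by (intro reduced.Cons) auto
next
  case (Cons c' p b a k)
  have "reduced a (letter G I a \<otimes>\<^bsub>P\<^esub> inc k \<otimes>\<^bsub>P\<^esub> (p \<otimes>\<^bsub>P\<^esub> inc g \<otimes>\<^bsub>P\<^esub> q)) d"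
    using Cons by (intro reduced.Cons) auto
  thus ?case using Cons reduced_closed by (simp add: inc.H.m_assoc)
qed

lemma reduced_inv:
  assumes "reduced a p b"
  shows "reduced (flip b) (inv\<^bsub>P\<^esub> p) (flip a)"
  using assms
proof (induction)
  case (letter a)
  thus ?case by (auto simp: inv_letter intro: reduced.letter)
next
  case (Cons c p b a g)
  have "reduced (flip b) (inv\<^bsub>P\<^esub> p \<otimes>\<^bsub>P\<^esub> inc (inv g) \<otimes>\<^bsub>P\<^esub> letter G I (flip a)) (flip a)"
    using Cons by (intro reduced_join[where c = "flip a"] reduced.letter) auto
  thus ?case
    using Cons reduced_closed by (simp add: inc.H.inv_mult_group inc.H.m_assoc inv_letter)
qed

text \<open>Applied to the normal form of \<open>1\<close>, a reduced product never meets a cancellation, so the result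
  contains letters; an element of \<open>G\<close> produces a normal form without letters.\<close>

lemma reduced_not_in_image:
  assumes "reduced a p b" "g \<in> carrier G"
  shows "p \<noteq> inc g"
proof
  assume p: "p = inc g"
  obtain act where act_mult: "\<And>p q s. \<lbrakk>p \<in> carrier P; q \<in> carrier P; s \<in> normal_forms\<rbrakk>
      \<Longrightarrow> act (p \<otimes>\<^bsub>P\<^esub> q) s = act p (act q s)"
    and act_inc: "\<And>g s. \<lbrakk>g \<in> carrier G; s \<in> normal_forms\<rbrakk> \<Longrightarrow> act (inc g) s = scale g s"
    and act_letter: "\<And>a s. \<lbrakk>a \<in> letters; s \<in> normal_forms\<rbrakk> \<Longrightarrow> act (letter G I a) s = push a s"
    using G_free_action by blast
  let ?s = "(\<one>, []) :: 'g \<times> (('i \<times> bool) \<times> 'g) list"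
  have s: "?s \<in> normal_forms" by (simp add: normal_forms_def)
  have "\<exists>k w. act p ?s = (\<one>, (a, k) # w) \<and> act p ?s \<in> normal_forms"
    using assms(1)
  proof (induction)
    case (letter a)
    thus ?case using act_letter s push_closed[OF letter s] by simp
  next
    case (Cons c p b a g)
    then obtain k w where p: "act p ?s = (\<one>, (c, k) # w)" "act p ?s \<in> normal_forms" by blast
    have "act (letter G I a \<otimes>\<^bsub>P\<^esub> inc g \<otimes>\<^bsub>P\<^esub> p) ?s = push a (scale g (act p ?s))"
    proof -
      have [simp]: "letter G I a \<in> carrier P" "inc g \<in> carrier P" "p \<in> carrier P"
        using Cons reduced_closed by simp_all
      have scaled: "scale g (act p ?s) \<in> normal_forms"
        using Cons p(2) by (intro scale_closed)
      have "act (letter G I a \<otimes>\<^bsub>P\<^esub> inc g \<otimes>\<^bsub>P\<^esub> p) ?s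
          = act (letter G I a \<otimes>\<^bsub>P\<^esub> (inc g \<otimes>\<^bsub>P\<^esub> p)) ?s"
        by (simp add: inc.H.m_assoc)
      also have "\<dots> = act (letter G I a) (act (inc g \<otimes>\<^bsub>P\<^esub> p) ?s)"
        by (rule act_mult) (simp_all add: s)
      also have "act (inc g \<otimes>\<^bsub>P\<^esub> p) ?s = act (inc g) (act p ?s)"
        by (rule act_mult) (simp_all add: s)
      also have "\<dots> = scale g (act p ?s)"
        using Cons p(2) by (intro act_inc)
      also have "act (letter G I a) (scale g (act p ?s)) = push a (scale g (act p ?s))"
        using Cons scaled by (intro act_letter)
      finally show ?thesis .
    qed
    moreover have "push a (scale g (act p ?s)) \<in> normal_forms"
      using Cons p by (intro push_closed scale_closed)
    ultimately show ?case using Cons p(1) by auto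
  qed
  thus False using act_inc s assms(2) unfolding p by auto
qed

text \<open>The elements of the stated form, together with \<open>G\<close>, are closed under left multiplication by \<open>G\<close> and by
  letters.  The only case in which the first letter of the reduced product is lost is that of a letter
  meeting its inverse; then either the whole product or just its first letter disappears.\<close>

lemma reduced_factor:
  assumes "p \<in> carrier P" "p \<notin> inc ` carrier G"
  shows "\<exists>g\<in>carrier G. \<exists>q. (\<exists>a b. reduced a q b) \<and> (\<exists>g'\<in>carrier G. p = inc g \<otimes>\<^bsub>P\<^esub> q \<otimes>\<^bsub>P\<^esub> inc g')"
proof -
  define nf where "nf p \<longleftrightarrow> p \<in> inc ` carrier G \<or> (\<exists>g\<in>carrier G. \<exists>q. (\<exists>a b. reduced a q b) \<and>
    (\<exists>g'\<in>carrier G. p = inc g \<otimes>\<^bsub>P\<^esub> q \<otimes>\<^bsub>P\<^esub> inc g'))" for p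
  have nfI: "nf (inc g \<otimes>\<^bsub>P\<^esub> q \<otimes>\<^bsub>P\<^esub> inc g')" if "reduced a q b" "g \<in> carrier G" "g' \<in> carrier G"
    for a b g g' q
    using that unfolding nf_def by blast
  have "nf p"
    using assms(1)
  proof (induction rule: G_free_induct)
    case one
    show ?case unfolding nf_def by (metis G.one_closed image_eqI inc.hom_one)
  next
    case (incl k p)
    from \<open>nf p\<close> consider g where "g \<in> carrier G" "p = inc g"
      | g a q b g' where "g \<in> carrier G" "reduced a q b" "g' \<in> carrier G"
        "p = inc g \<otimes>\<^bsub>P\<^esub> q \<otimes>\<^bsub>P\<^esub> inc g'"
      unfolding nf_def by blast
    thus ?case
    proof cases
      case 1
      hence "inc k \<otimes>\<^bsub>P\<^esub> p = inc (k \<otimes> g)" using incl by simp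
      thus ?thesis unfolding nf_def using incl 1 by blast
    next
      case 2
      hence "inc k \<otimes>\<^bsub>P\<^esub> p = inc (k \<otimes> g) \<otimes>\<^bsub>P\<^esub> q \<otimes>\<^bsub>P\<^esub> inc g'"
        using incl reduced_closed by (simp add: inc.H.m_assoc)
      moreover have "k \<otimes> g \<in> carrier G" using incl 2 by simp
      ultimately show ?thesis using nfI 2 by metis
    qed
  next
    case (letter c p)
    from \<open>nf p\<close> consider g where "g \<in> carrier G" "p = inc g"
      | g a q b g' where "g \<in> carrier G" "reduced a q b" "g' \<in> carrier G"
        "p = inc g \<otimes>\<^bsub>P\<^esub> q \<otimes>\<^bsub>P\<^esub> inc g'"
      unfolding nf_def by blast
    thus ?case
    proof cases
      case 1
      thus ?thesis using nfI[OF reduced.letter[of c], of \<one> g] letter by simp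
    next
      case 2
      have [simp]: "letter G I c \<in> carrier P" "q \<in> carrier P"
        using letter 2 reduced_closed by simp_all
      show ?thesis
      proof (cases "g = \<one> \<and> a = flip c")
        case False
        hence "reduced c (letter G I c \<otimes>\<^bsub>P\<^esub> inc g \<otimes>\<^bsub>P\<^esub> q) b"
          using 2 letter by (intro reduced.Cons) auto
        moreover have "letter G I c \<otimes>\<^bsub>P\<^esub> p
            = inc \<one> \<otimes>\<^bsub>P\<^esub> (letter G I c \<otimes>\<^bsub>P\<^esub> inc g \<otimes>\<^bsub>P\<^esub> q) \<otimes>\<^bsub>P\<^esub> inc g'"
          using 2 by (simp add: inc.H.m_assoc)
        ultimately show ?thesis using nfI 2 by (metis G.one_closed)
      next
        case True
        hence p: "letter G I c \<otimes>\<^bsub>P\<^esub> p = letter G I c \<otimes>\<^bsub>P\<^esub> q \<otimes>\<^bsub>P\<^esub> inc g'"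
          using 2 by (simp add: inc.H.m_assoc)
        from \<open>reduced a q b\<close> show ?thesis
        proof cases
          case letter
          hence "letter G I c \<otimes>\<^bsub>P\<^esub> p = inc g'"
            using p True 2 letter_mult_flip \<open>c \<in> letters\<close> by simp
          thus ?thesis using 2 unfolding nf_def by blast
        next
          case (Cons a' q' k)
          have [simp]: "q' \<in> carrier P" using Cons reduced_closed by blast
          have "letter G I c \<otimes>\<^bsub>P\<^esub> q
              = letter G I c \<otimes>\<^bsub>P\<^esub> letter G I (flip c) \<otimes>\<^bsub>P\<^esub> (inc k \<otimes>\<^bsub>P\<^esub> q')"
            using Cons True by (simp add: inc.H.m_assoc)
          also have "\<dots> = inc k \<otimes>\<^bsub>P\<^esub> q'"
            using letter_mult_flip \<open>c \<in> letters\<close> Cons by simp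
          finally show ?thesis using nfI 2 Cons p by simp
        qed
      qed
    qed
  qed
  thus ?thesis using assms(2) unfolding nf_def by blast
qed

lemma reduced_products_G_free: "reduced_products G P inc {p. \<exists>a b. reduced a p b}"
proof (unfold_locales, goal_cases)
  case (1 p)
  thus ?case using reduced_closed by blast
next
  case (2 p)
  thus ?case using reduced_inv by blast
next
  case (3 p q g)
  thus ?case using reduced_join by blast
next
  case (4 p g)
  thus ?case using reduced_not_in_image by blast
next
  case (5 p)
  thus ?case using reduced_factor by blast
qed

end

section \<open>Divisors of zero\<close>

lemma (in group) commute_if_commutator_one:
  assumes "a \<in> carrier G" "b \<in> carrier G" "a \<otimes> b \<otimes> inv a \<otimes> inv b = \<one>"
  shows "a \<otimes> b = b \<otimes> a"
proof -
  have "a \<otimes> b \<otimes> inv (b \<otimes> a) = \<one>" using assms by (simp add: inv_mult_group m_assoc)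
  thus ?thesis using assms by (metis inv_closed inv_equality inv_inv m_closed)
qed

text \<open>Both elements are among the generators of the orbit subgroups, \<open>y\<close> being its own conjugate by \<open>\<one>\<close>.\<close>

lemma (in group_hom) conj_commute_if_orbit_subgroups_commute:
  assumes "commutator_subgroup H (G_orbit_subgroup G H h x) (G_orbit_subgroup G H h y) = {\<one>\<^bsub>H\<^esub>}"
    and "x \<in> carrier H" "y \<in> carrier H" "g \<in> carrier G"
  shows "(h g \<otimes>\<^bsub>H\<^esub> x \<otimes>\<^bsub>H\<^esub> inv\<^bsub>H\<^esub> h g) \<otimes>\<^bsub>H\<^esub> y = y \<otimes>\<^bsub>H\<^esub> (h g \<otimes>\<^bsub>H\<^esub> x \<otimes>\<^bsub>H\<^esub> inv\<^bsub>H\<^esub> h g)"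
proof -
  let ?x = "h g \<otimes>\<^bsub>H\<^esub> x \<otimes>\<^bsub>H\<^esub> inv\<^bsub>H\<^esub> h g"
  have "?x \<in> G_orbit_subgroup G H h x"
    using assms(4) unfolding G_orbit_subgroup_def by (blast intro: generate.incl)
  moreover have "h \<one> \<otimes>\<^bsub>H\<^esub> y \<otimes>\<^bsub>H\<^esub> inv\<^bsub>H\<^esub> h \<one> \<in> G_orbit_subgroup G H h y"
    unfolding G_orbit_subgroup_def by (blast intro: generate.incl)
  hence "y \<in> G_orbit_subgroup G H h y" using assms(3) by simp
  ultimately have "?x \<otimes>\<^bsub>H\<^esub> y \<otimes>\<^bsub>H\<^esub> inv\<^bsub>H\<^esub> ?x \<otimes>\<^bsub>H\<^esub> inv\<^bsub>H\<^esub> y \<in> {\<one>\<^bsub>H\<^esub>}"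
    unfolding assms(1)[symmetric] commutator_subgroup_def by (blast intro: generate.incl)
  thus ?thesis using assms by (intro H.commute_if_commutator_one) auto
qed

theorem theorem2p1:
  fixes G :: "('g, 'm) monoid_scheme" and I :: "'i set"
    and x :: "('g + ('i \<times> bool) list set) list set"
  assumes "group G"
    and "\<not> trivial_group G"
    and "\<not> (cyclic_group G \<and> order G = 2)"
    and "x \<in> carrier (G_free G I)"
    and "T1_zero_divisor G (G_free G I) (G_free_incl G I) x"
  shows "x \<in> G_free_incl G I ` carrier G"
proof -
  interpret G: group G by fact
  interpret G_free_group G I by unfold_locales
  interpret reduced_products G P inc "{p. \<exists>a b. reduced a p b}"
    by (rule reduced_products_G_free)
  obtain y where y: "y \<in> carrier P" "y \<noteq> \<one>\<^bsub>P\<^esub>"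
    "commutator_subgroup P (G_orbit_subgroup G P inc x) (G_orbit_subgroup G P inc y) = {\<one>\<^bsub>P\<^esub>}"
    using assms(5) unfolding T1_zero_divisor_def by blast
  have "orth x y"
    unfolding orth_def conj_by_def
    using inc.conj_commute_if_orbit_subgroups_commute[OF y(3) assms(4) y(1)] by blast
  thus ?thesis
    using orth_left_in_image[OF G.ex_third_element[OF assms(2,3)]] assms(4) y(1,2) by blast
qed

end
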